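(* Consider the system $$\begin{aligned} \frac{dx}{dt} &=\frac{2x^2y}{t}+x^2-\frac{2xy}{t}-\left(1+\frac{2\alpha_2+2\alpha_3+\alpha_5+\alpha_4}{t}\right)x+\frac{\alpha_2+\alpha_5}{t}+\frac{2z((z-1)w+\alpha_3)}{t},\\ \frac{dy}{dt} &=-\frac{2xy^2}{t}+\frac{y^2}{t}-2xy+\left(1+\frac{2\alpha_2+2\alpha_3+\alpha_5+\alpha_4}{t}\right)y-\alpha_1,\\ \frac{dz}{dt} &=\frac{2z^2w}{t}+z^2-\frac{2zw}{t}-\left(1+\frac{\alpha_5+\alpha_4}{t}\right)z+\frac{\alpha_5}{t}+\frac{2yz(z-1)}{t},\\ \frac{dw}{dt} &=-\frac{2zw^2}{t}+\frac{w^2}{t}-2zw+\left(1+\frac{\alpha_5+\alpha_4}{t}\right)w-\alpha_3-\frac{2y(-w+2zw+\alpha_3)}{t} \end{aligned}$$ with complex parameters satisfying $\alpha_0+\alpha_1+2\alpha_2+2\alpha_3+\alpha_4+\alpha_5=1$. Make the change of parameters and variables $$\alpha_0=A_0,\ \alpha_1=A_1,\ \alpha_2=A_2,\ \alpha_3=A_3,\ \alpha_4=2A_4-\frac1\varepsilon,\ \alpha_5=\frac1\varepsilon,$$ $$t=-\varepsilon T,\quad x=1+\frac{X}{\varepsilon T},\quad y=\varepsilon TY,\quad z=1+\frac{Z}{\varepsilon T},\quad w=\varepsilon TW$$ from $\alpha_0,\dots,\alpha_5,t,x,y,z,w$ to $A_0,\dots,A_4,\varepsilon,T,X,Y,Z,W$.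 Then the system can also be written in the new variables $T,X,Y,Z,W$ and parameters $A_0,\dots,A_4,\varepsilon$ as a Hamiltonian system, and this new system tends, as $\varepsilon\to0$, to the system of type $B_4^{(1)}$ $$\begin{aligned} \frac{dX}{dT} &=\frac{2X^2Y-X^2+(A_0+A_1)X+2A_3Z+2Z^2W}{T}+1,\\ \frac{dY}{dT} &=\frac{-2XY^2+2XY-(A_0+A_1)Y+A_1}{T},\\ \frac{dZ}{dT} &=\frac{2Z^2W-Z^2+(A_0+A_1+2A_2+2A_3)Z+2YZ^2}{T}+1,\\ \frac{dW}{dT} &=\frac{-2ZW^2+2ZW-(A_0+A_1+2A_2+2A_3)W-2A_3Y-4YZW+A_3}{T}, \end{aligned}$$ where $A_0+A_1+2A_2+2A_3+2A_4=1$.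
   Context: A Hamiltonian system in $(X,Y,Z,W)$ with independent variable $T$ is one of the form $dX/dT=\partial K/\partial Y$, $dY/dT=-\partial K/\partial X$, $dZ/dT=\partial K/\partial W$, $dW/dT=-\partial K/\partial Z$. "Tends to" means that the right-hand sides of the transformed system converge to those of the limiting system as $\varepsilon\to0$ with $T,X,Y,Z,W,A_0,\dots,A_4$ fixed. *)

theory Defs
  imports "HOL-Analysis.Analysis"
begin

text \<open>
  Everything is complex, including the time variables. A point of the phase space is a
  quadruple of complex numbers, and a non-autonomous system is given by its right-hand side,
  a function of time and of the phase point.
\<close>

type_synonym phase = "complex \<times> complex \<times> complex \<times> complex"

text \<open>
  Solutions are functions with complex derivatives; only their values on \<open>S\<close> (meant to be
  open) matter.
\<close>

definition solves_on :: "(complex \<Rightarrow> phase \<Rightarrow> phase) \<Rightarrow> complex set \<Rightarrow> (complex \<Rightarrow> phase) \<Rightarrow> bool" where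
  "solves_on F S u \<longleftrightarrow>
     (\<forall>t\<in>S. case F t (u t) of (f1, f2, f3, f4) \<Rightarrow>
        ((\<lambda>s. fst (u s)) has_field_derivative f1) (at t) \<and>
        ((\<lambda>s. fst (snd (u s))) has_field_derivative f2) (at t) \<and>
        ((\<lambda>s. fst (snd (snd (u s)))) has_field_derivative f3) (at t) \<and>
        ((\<lambda>s. snd (snd (snd (u s)))) has_field_derivative f4) (at t))"

text \<open>
  The system \<open>F\<close>, with times in \<open>D\<close>, is the Hamiltonian system of \<open>K\<close>: its right-hand side is
  \<open>(\<partial>K/\<partial>Y, - \<partial>K/\<partial>X, \<partial>K/\<partial>W, - \<partial>K/\<partial>Z)\<close>, the partial derivatives being required to exist.
\<close>

definition hamiltonian_system_on ::
  "complex set \<Rightarrow> (complex \<Rightarrow> phase \<Rightarrow> complex) \<Rightarrow> (complex \<Rightarrow> phase \<Rightarrow> phase) \<Rightarrow> bool" where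
  "hamiltonian_system_on D K F \<longleftrightarrow>
     (\<forall>T\<in>D. \<forall>X Y Z W. case F T (X, Y, Z, W) of (f1, f2, f3, f4) \<Rightarrow>
        ((\<lambda>Y. K T (X, Y, Z, W)) has_field_derivative f1) (at Y) \<and>
        ((\<lambda>X. K T (X, Y, Z, W)) has_field_derivative (- f2)) (at X) \<and>
        ((\<lambda>W. K T (X, Y, Z, W)) has_field_derivative f3) (at W) \<and>
        ((\<lambda>Z. K T (X, Y, Z, W)) has_field_derivative (- f4)) (at Z))"

definition original_system ::
  "complex \<Rightarrow> complex \<Rightarrow> complex \<Rightarrow> complex \<Rightarrow> complex \<Rightarrow> complex \<Rightarrow> phase \<Rightarrow> phase" where
  "original_system \<alpha>1 \<alpha>2 \<alpha>3 \<alpha>4 \<alpha>5 t = (\<lambda>(x, y, z, w).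
    (2 * x^2 * y / t + x^2 - 2 * x * y / t
       - (1 + (2 * \<alpha>2 + 2 * \<alpha>3 + \<alpha>5 + \<alpha>4) / t) * x + (\<alpha>2 + \<alpha>5) / t
       + 2 * z * ((z - 1) * w + \<alpha>3) / t,
     - (2 * x * y^2 / t) + y^2 / t - 2 * x * y
       + (1 + (2 * \<alpha>2 + 2 * \<alpha>3 + \<alpha>5 + \<alpha>4) / t) * y - \<alpha>1,
     2 * z^2 * w / t + z^2 - 2 * z * w / t
       - (1 + (\<alpha>5 + \<alpha>4) / t) * z + \<alpha>5 / t + 2 * y * z * (z - 1) / t,
     - (2 * z * w^2 / t) + w^2 / t - 2 * z * w
       + (1 + (\<alpha>5 + \<alpha>4) / t) * w - \<alpha>3 - 2 * y * (- w + 2 * z * w + \<alpha>3) / t))"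

definition B4_system ::
  "complex \<Rightarrow> complex \<Rightarrow> complex \<Rightarrow> complex \<Rightarrow> complex \<Rightarrow> phase \<Rightarrow> phase" where
  "B4_system A0 A1 A2 A3 T = (\<lambda>(X, Y, Z, W).
    ((2 * X^2 * Y - X^2 + (A0 + A1) * X + 2 * A3 * Z + 2 * Z^2 * W) / T + 1,
     (- (2 * X * Y^2) + 2 * X * Y - (A0 + A1) * Y + A1) / T,
     (2 * Z^2 * W - Z^2 + (A0 + A1 + 2 * A2 + 2 * A3) * Z + 2 * Y * Z^2) / T + 1,
     (- (2 * Z * W^2) + 2 * Z * W - (A0 + A1 + 2 * A2 + 2 * A3) * W
       - 2 * A3 * Y - 4 * Y * Z * W + A3) / T))"

text \<open>The old variables \<open>t\<close> and \<open>(x, y, z, w)\<close> in terms of \<open>\<epsilon>\<close>, \<open>T\<close> and \<open>(X, Y, Z, W)\<close>.\<close>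

definition old_time :: "complex \<Rightarrow> complex \<Rightarrow> complex" where
  "old_time \<epsilon> T = - \<epsilon> * T"

definition old_state :: "complex \<Rightarrow> complex \<Rightarrow> phase \<Rightarrow> phase" where
  "old_state \<epsilon> T = (\<lambda>(X, Y, Z, W).
     (1 + X / (\<epsilon> * T), \<epsilon> * T * Y, 1 + Z / (\<epsilon> * T), \<epsilon> * T * W))"

text \<open>
  \<open>G\<close> is the system \<open>F\<close> written in the new variables: whenever \<open>u\<close> (a function of \<open>t\<close>) and
  \<open>v\<close> (a function of \<open>T\<close>) correspond to each other under the change of variables, \<open>u\<close> solves
  \<open>F\<close> if and only if \<open>v\<close> solves \<open>G\<close>.
\<close>

definition rewritten_as ::
  "complex \<Rightarrow> (complex \<Rightarrow> phase \<Rightarrow> phase) \<Rightarrow> (complex \<Rightarrow> phase \<Rightarrow> phase) \<Rightarrow> bool" where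
  "rewritten_as \<epsilon> F G \<longleftrightarrow>
     (\<forall>S u v. open S \<longrightarrow> 0 \<notin> S \<longrightarrow> (\<forall>T\<in>S. u (old_time \<epsilon> T) = old_state \<epsilon> T (v T)) \<longrightarrow>
        (solves_on F (old_time \<epsilon> ` S) u \<longleftrightarrow> solves_on G S v))"

end

theory Submission imports Defs begin

text \<open>
  For \<open>\<epsilon> \<noteq> 0\<close> the change of variables consists of the time scaling \<open>t = - \<epsilon> T\<close> and, for each
  coordinate separately, of an affine substitution whose scaling factor is \<open>\<epsilon> T\<close> or its inverse.
  The chain rule and the product rule therefore give the system in the new variables explicitly.
  Written with \<open>f\<close>, \<open>g\<close> for the right-hand sides of the equations for \<open>x\<close>, \<open>y\<close>, these rules give
  \<open>dX/dT = X / T + \<epsilon> t f\<close> and \<open>dY/dT = - Y / T - g / T\<close>, and likewise for \<open>Z\<close>, \<open>W\<close>.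
  The result is \<^emph>\<open>affine\<close> in \<open>\<epsilon>\<close>: the poles of \<open>x\<close> and \<open>z\<close> are matched by the zeros of
  \<open>y\<close>, \<open>w\<close> and \<open>t\<close> or by the factor \<open>\<epsilon>\<close> just displayed, and the poles of \<open>\<alpha>\<^sub>4\<close> and
  \<open>\<alpha>\<^sub>5\<close> cancel in \<open>\<alpha>\<^sub>4 + \<alpha>\<^sub>5 = 2 A\<^sub>4\<close>. The one remaining \<open>\<alpha>\<^sub>5 = 1 / \<epsilon>\<close>
  in the equations for \<open>x\<close> and \<open>z\<close> becomes the summand \<open>1\<close> in those for \<open>X\<close> and \<open>Z\<close>. Thus the new
  right-hand side is \<open>B + \<epsilon> P\<close>, where \<open>B\<close> is the system of type \<open>B\<^sub>4\<^sup>(\<^sup>1\<^sup>)\<close> and the polynomial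
  field \<open>P\<close> does not involve \<open>\<epsilon>\<close> (lemma \<open>rewritten_as_transformed_system\<close>), so that the limit
  is immediate.

  Each of \<open>B\<close> and \<open>P\<close> is Hamiltonian with a polynomial Hamiltonian in the phase variables, found by
  integrating the first and third components with respect to \<open>Y\<close> and \<open>W\<close>, up to terms in
  \<open>X\<close> and \<open>Z\<close> alone, which the other two components determine; hence \<open>B + \<epsilon> P\<close>
  is Hamiltonian too (lemma \<open>hamiltonian_transformed_system\<close>).
\<close>

text \<open>
  One coordinate of the change of variables. Both directions are the product and chain rules;
  the converse one reads the relation as \<open>q = (p - a) / c\<close> and the time scaling backwards.
\<close>

lemma has_field_derivative_rescaled_iff:
  fixes p q c :: "complex \<Rightarrow> complex"
  assumes "\<epsilon> \<noteq> 0" "open S" "T \<in> S"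
    and p: "\<And>T. T \<in> S \<Longrightarrow> p (- \<epsilon> * T) = a + c T * q T"
    and c: "(c has_field_derivative c') (at T)" "\<And>T. T \<in> S \<Longrightarrow> c T \<noteq> 0"
    and d: "- \<epsilon> * d = c' * q T + c T * e"
  shows "(p has_field_derivative d) (at (- \<epsilon> * T)) \<longleftrightarrow> (q has_field_derivative e) (at T)"
proof -
  have "(p has_field_derivative d) (at (- \<epsilon> * T)) \<longleftrightarrow>
      ((\<lambda>T. p (- \<epsilon> * T)) has_field_derivative (- \<epsilon> * d)) (at T)" (is "?P \<longleftrightarrow> ?Q")
  proof
    assume ?P
    then show ?Q
      by (rule DERIV_chain'[rotated, THEN DERIV_cong]) (auto intro!: derivative_eq_intros)
  next
    assume ?Q
    then have "((\<lambda>T. p (- \<epsilon> * T)) has_field_derivative (- \<epsilon> * d)) (at (- (- \<epsilon> * T) / \<epsilon>))"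
      using \<open>\<epsilon> \<noteq> 0\<close> by simp
    then have "((\<lambda>t. p (- \<epsilon> * (- t / \<epsilon>))) has_field_derivative d) (at (- \<epsilon> * T))"
      by (rule DERIV_chain'[rotated, where f = "\<lambda>t. - t / \<epsilon>" and D = "- 1 / \<epsilon>", THEN DERIV_cong])
        (use \<open>\<epsilon> \<noteq> 0\<close> in \<open>auto intro!: derivative_eq_intros\<close>)
    then show ?P
      using \<open>\<epsilon> \<noteq> 0\<close> by simp
  qed
  also have "?Q \<longleftrightarrow> (q has_field_derivative e) (at T)"
  proof
    assume ?Q
    then have "((\<lambda>T. (p (- \<epsilon> * T) - a) / c T) has_field_derivative e) (at T)"
      using c d p \<open>T \<in> S\<close>
      by (auto intro!: derivative_eq_intros simp: field_simps)
    then show "(q has_field_derivative e) (at T)"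
      by (rule has_field_derivative_transform_within_open[OF _ \<open>open S\<close> \<open>T \<in> S\<close>])
        (use c p in auto)
  next
    assume "(q has_field_derivative e) (at T)"
    then have "((\<lambda>T. a + c T * q T) has_field_derivative (- \<epsilon> * d)) (at T)"
      using c(1) d by (auto intro!: derivative_eq_intros)
    then show ?Q
      by (rule has_field_derivative_transform_within_open[OF _ \<open>open S\<close> \<open>T \<in> S\<close>])
        (use p in auto)
  qed
  finally show ?thesis .
qed

text \<open>
  Reduces the statement about solutions to an algebraic identity between the two right-hand sides.
  The identity is \<open>has_field_derivative_rescaled_iff\<close> solved for the old right-hand side, with
  scaling factor \<open>1 / (\<epsilon> T)\<close> for \<open>x\<close>, \<open>z\<close> and \<open>\<epsilon> T\<close> for \<open>y\<close>, \<open>w\<close>.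
\<close>

lemma rewritten_asI:
  assumes "\<epsilon> \<noteq> 0"
    and FG: "\<And>T X Y Z W. T \<noteq> 0 \<Longrightarrow>
      F (old_time \<epsilon> T) (old_state \<epsilon> T (X, Y, Z, W)) =
        (case G T (X, Y, Z, W) of (g1, g2, g3, g4) \<Rightarrow>
          ((X / T - g1) / (\<epsilon>^2 * T), - (Y + T * g2), (Z / T - g3) / (\<epsilon>^2 * T), - (W + T * g4)))"
  shows "rewritten_as \<epsilon> F G"
  unfolding rewritten_as_def
proof (intro allI impI)
  fix S u v
  assume S: "open S" "0 \<notin> S" and uv: "\<forall>T\<in>S. u (old_time \<epsilon> T) = old_state \<epsilon> T (v T)"
  have pole: "(p has_field_derivative (q T / T - e) / (\<epsilon>^2 * T)) (at (- \<epsilon> * T)) \<longleftrightarrow>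
      (q has_field_derivative e) (at T)"
    if "T \<in> S" and pq: "\<And>T. T \<in> S \<Longrightarrow> p (- \<epsilon> * T) = 1 + q T / (\<epsilon> * T)" for p q e T
  proof -
    have "T \<noteq> 0"
      using \<open>T \<in> S\<close> S by auto
    then show ?thesis
      by (intro has_field_derivative_rescaled_iff[where a = 1 and c = "\<lambda>T. 1 / (\<epsilon> * T)"
            and c' = "- 1 / (\<epsilon> * T^2)", OF \<open>\<epsilon> \<noteq> 0\<close> \<open>open S\<close> \<open>T \<in> S\<close>])
        (use pq S \<open>\<epsilon> \<noteq> 0\<close> in
          \<open>auto intro!: derivative_eq_intros simp: field_simps power2_eq_square\<close>)
  qed
  have zero: "(p has_field_derivative - (q T + T * e)) (at (- \<epsilon> * T)) \<longleftrightarrow>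
      (q has_field_derivative e) (at T)"
    if "T \<in> S" and pq: "\<And>T. T \<in> S \<Longrightarrow> p (- \<epsilon> * T) = \<epsilon> * T * q T" for p q e T
    by (rule has_field_derivative_rescaled_iff[where a = 0 and c = "\<lambda>T. \<epsilon> * T"
          and c' = \<epsilon>, OF \<open>\<epsilon> \<noteq> 0\<close> \<open>open S\<close> \<open>T \<in> S\<close>])
      (use that S \<open>\<epsilon> \<noteq> 0\<close> in \<open>auto intro!: derivative_eq_intros simp: algebra_simps\<close>)
  have uv': "fst (u (- \<epsilon> * T)) = 1 + fst (v T) / (\<epsilon> * T)"
      "fst (snd (u (- \<epsilon> * T))) = \<epsilon> * T * fst (snd (v T))"
      "fst (snd (snd (u (- \<epsilon> * T)))) = 1 + fst (snd (snd (v T))) / (\<epsilon> * T)"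
      "snd (snd (snd (u (- \<epsilon> * T)))) = \<epsilon> * T * snd (snd (snd (v T)))" if "T \<in> S" for T
    using uv that by (simp_all add: old_state_def old_time_def split_def)
  show "solves_on F (old_time \<epsilon> ` S) u \<longleftrightarrow> solves_on G S v"
    unfolding solves_on_def ball_simps
  proof (rule ball_cong[OF refl])
    fix T assume T: "T \<in> S"
    obtain X Y Z W where v: "v T = (X, Y, Z, W)" by (metis prod.exhaust)
    obtain g1 g2 g3 g4 where g: "G T (X, Y, Z, W) = (g1, g2, g3, g4)" by (metis prod.exhaust)
    have F: "F (old_time \<epsilon> T) (u (old_time \<epsilon> T)) =
        ((X / T - g1) / (\<epsilon>^2 * T), - (Y + T * g2), (Z / T - g3) / (\<epsilon>^2 * T), - (W + T * g4))"
      using FG[of T X Y Z W] uv T S v g by auto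
    note comps =
      pole[where p = "\<lambda>t. fst (u t)" and q = "\<lambda>T. fst (v T)" and e = g1, OF T uv'(1)]
      zero[where p = "\<lambda>t. fst (snd (u t))" and q = "\<lambda>T. fst (snd (v T))" and e = g2, OF T uv'(2)]
      pole[where p = "\<lambda>t. fst (snd (snd (u t)))" and q = "\<lambda>T. fst (snd (snd (v T)))" and e = g3,
        OF T uv'(3)]
      zero[where p = "\<lambda>t. snd (snd (snd (u t)))" and q = "\<lambda>T. snd (snd (snd (v T)))" and e = g4,
        OF T uv'(4)]
    show "(case F (old_time \<epsilon> T) (u (old_time \<epsilon> T)) of (f1, f2, f3, f4) \<Rightarrow>
        ((\<lambda>s. fst (u s)) has_field_derivative f1) (at (old_time \<epsilon> T)) \<and>
        ((\<lambda>s. fst (snd (u s))) has_field_derivative f2) (at (old_time \<epsilon> T)) \<and>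
        ((\<lambda>s. fst (snd (snd (u s)))) has_field_derivative f3) (at (old_time \<epsilon> T)) \<and>
        ((\<lambda>s. snd (snd (snd (u s)))) has_field_derivative f4) (at (old_time \<epsilon> T))) \<longleftrightarrow>
      (case G T (v T) of (f1, f2, f3, f4) \<Rightarrow>
        ((\<lambda>s. fst (v s)) has_field_derivative f1) (at T) \<and>
        ((\<lambda>s. fst (snd (v s))) has_field_derivative f2) (at T) \<and>
        ((\<lambda>s. fst (snd (snd (v s)))) has_field_derivative f3) (at T) \<and>
        ((\<lambda>s. snd (snd (snd (v s)))) has_field_derivative f4) (at T))"
      using comps unfolding F v g by (simp add: v old_time_def)
  qed
qed

definition B4_perturbation :: "complex \<Rightarrow> complex \<Rightarrow> phase \<Rightarrow> phase" where
  "B4_perturbation A2 A4 = (\<lambda>(X, Y, Z, W).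
     (2 * X * Y - X + 2 * Z * W - (A2 + 2 * A4), Y - Y^2,
      2 * Z * W - Z + 2 * Y * Z - 2 * A4, W - W^2 - 2 * Y * W))"

text \<open>
  The product with \<open>\<epsilon>\<close> is spelled out by components: quadruples of complex numbers carry only real
  scalars.
\<close>

definition transformed_system ::
  "complex \<Rightarrow> complex \<Rightarrow> complex \<Rightarrow> complex \<Rightarrow> complex \<Rightarrow> complex \<Rightarrow> complex \<Rightarrow> phase \<Rightarrow> phase" where
  "transformed_system A0 A1 A2 A3 A4 \<epsilon> T p =
     B4_system A0 A1 A2 A3 T p +
     (case B4_perturbation A2 A4 p of (p1, p2, p3, p4) \<Rightarrow> (\<epsilon> * p1, \<epsilon> * p2, \<epsilon> * p3, \<epsilon> * p4))"

text \<open>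
  The parameter relation enters where the derivatives of the scaling factors contribute
  \<open>X / T\<close>, \<open>- Y / T\<close>, \<open>Z / T\<close>, \<open>- W / T\<close>: it turns \<open>1 - (2 A\<^sub>2 + 2 A\<^sub>3 + 2 A\<^sub>4)\<close> into
  \<open>A\<^sub>0 + A\<^sub>1\<close>, and \<open>1 - 2 A\<^sub>4\<close> into \<open>A\<^sub>0 + A\<^sub>1 + 2 A\<^sub>2 + 2 A\<^sub>3\<close>.
\<close>

lemma rewritten_as_transformed_system:
  assumes "\<epsilon> \<noteq> 0" and A: "A0 + A1 + 2 * A2 + 2 * A3 + 2 * A4 = 1"
  shows "rewritten_as \<epsilon> (original_system A1 A2 A3 (2 * A4 - 1 / \<epsilon>) (1 / \<epsilon>))
    (transformed_system A0 A1 A2 A3 A4 \<epsilon>)"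
proof (rule rewritten_asI[OF \<open>\<epsilon> \<noteq> 0\<close>])
  fix T X Y Z W :: complex
  assume "T \<noteq> 0"
  have A0: "A0 = 1 - A1 - 2 * A2 - 2 * A3 - 2 * A4"
    using A by (simp add: algebra_simps)
  show "original_system A1 A2 A3 (2 * A4 - 1 / \<epsilon>) (1 / \<epsilon>) (old_time \<epsilon> T)
      (old_state \<epsilon> T (X, Y, Z, W)) =
    (case transformed_system A0 A1 A2 A3 A4 \<epsilon> T (X, Y, Z, W) of (g1, g2, g3, g4) \<Rightarrow>
      ((X / T - g1) / (\<epsilon>^2 * T), - (Y + T * g2), (Z / T - g3) / (\<epsilon>^2 * T), - (W + T * g4)))"
    using \<open>\<epsilon> \<noteq> 0\<close> \<open>T \<noteq> 0\<close> unfolding A0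
    by (simp add: original_system_def old_time_def old_state_def transformed_system_def
        B4_system_def B4_perturbation_def field_simps power2_eq_square)
qed

text \<open>
  The quotient by \<open>T\<close> together with \<open>Y + W\<close> generates the limiting system; the
  multiple of \<open>\<epsilon>\<close> generates the perturbation.
\<close>

definition transformed_hamiltonian ::
  "complex \<Rightarrow> complex \<Rightarrow> complex \<Rightarrow> complex \<Rightarrow> complex \<Rightarrow> complex \<Rightarrow> complex \<Rightarrow> phase \<Rightarrow> complex" where
  "transformed_hamiltonian A0 A1 A2 A3 A4 \<epsilon> T = (\<lambda>(X, Y, Z, W).
     (X^2 * Y^2 - X^2 * Y + (A0 + A1) * X * Y - A1 * X
       + Z^2 * W^2 - Z^2 * W + (A0 + A1 + 2 * A2 + 2 * A3) * Z * W - A3 * Z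
       + 2 * Y * Z * (Z * W + A3)) / T + Y + W
     + \<epsilon> * (X * Y^2 - X * Y - (A2 + 2 * A4) * Y
         + Z * W^2 - Z * W - 2 * A4 * W + 2 * Y * Z * W))"

lemma hamiltonian_transformed_system:
  "hamiltonian_system_on (- {0}) (transformed_hamiltonian A0 A1 A2 A3 A4 \<epsilon>)
    (transformed_system A0 A1 A2 A3 A4 \<epsilon>)"
  unfolding hamiltonian_system_on_def transformed_hamiltonian_def transformed_system_def
    B4_system_def B4_perturbation_def
  by (auto intro!: derivative_eq_intros simp: field_simps power2_eq_square)

lemma tendsto_transformed_system:
  "((\<lambda>\<epsilon>. transformed_system A0 A1 A2 A3 A4 \<epsilon> T p) \<longlongrightarrow> B4_system A0 A1 A2 A3 T p) (at 0)"
proof -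
  have "((\<lambda>\<epsilon>. transformed_system A0 A1 A2 A3 A4 \<epsilon> T p) \<longlongrightarrow>
      transformed_system A0 A1 A2 A3 A4 0 T p) (at 0)"
    unfolding transformed_system_def split_def by (intro tendsto_intros)
  also have "transformed_system A0 A1 A2 A3 A4 0 T p = B4_system A0 A1 A2 A3 T p"
    by (simp add: transformed_system_def split_def flip: zero_prod_def)
  finally show ?thesis .
qed

theorem theorem3p3:
  fixes A0 A1 A2 A3 A4 :: complex
  shows "\<exists>(G :: complex \<Rightarrow> complex \<Rightarrow> phase \<Rightarrow> phase) (K :: complex \<Rightarrow> complex \<Rightarrow> phase \<Rightarrow> complex).
    (\<forall>\<epsilon> \<alpha>0 \<alpha>1 \<alpha>2 \<alpha>3 \<alpha>4 \<alpha>5 :: complex.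
       \<epsilon> \<noteq> 0 \<longrightarrow>
       \<alpha>0 + \<alpha>1 + 2 * \<alpha>2 + 2 * \<alpha>3 + \<alpha>4 + \<alpha>5 = 1 \<longrightarrow>
       \<alpha>0 = A0 \<longrightarrow> \<alpha>1 = A1 \<longrightarrow> \<alpha>2 = A2 \<longrightarrow> \<alpha>3 = A3 \<longrightarrow>
       \<alpha>4 = 2 * A4 - 1 / \<epsilon> \<longrightarrow> \<alpha>5 = 1 / \<epsilon> \<longrightarrow>
         A0 + A1 + 2 * A2 + 2 * A3 + 2 * A4 = 1 \<and>
         rewritten_as \<epsilon> (original_system \<alpha>1 \<alpha>2 \<alpha>3 \<alpha>4 \<alpha>5) (G \<epsilon>) \<and>
         hamiltonian_system_on (- {0}) (K \<epsilon>) (G \<epsilon>)) \<and>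
    (A0 + A1 + 2 * A2 + 2 * A3 + 2 * A4 = 1 \<longrightarrow>
       (\<forall>T X Y Z W. T \<noteq> 0 \<longrightarrow>
          ((\<lambda>\<epsilon>. G \<epsilon> T (X, Y, Z, W)) \<longlongrightarrow> B4_system A0 A1 A2 A3 T (X, Y, Z, W)) (at 0)))"
proof (intro exI conjI allI impI)
  fix \<epsilon> \<alpha>0 \<alpha>1 \<alpha>2 \<alpha>3 \<alpha>4 \<alpha>5 :: complex
  assume "\<epsilon> \<noteq> 0" and sum: "\<alpha>0 + \<alpha>1 + 2 * \<alpha>2 + 2 * \<alpha>3 + \<alpha>4 + \<alpha>5 = 1"
    and \<alpha>: "\<alpha>0 = A0" "\<alpha>1 = A1" "\<alpha>2 = A2" "\<alpha>3 = A3" "\<alpha>4 = 2 * A4 - 1 / \<epsilon>" "\<alpha>5 = 1 / \<epsilon>"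
  show A: "A0 + A1 + 2 * A2 + 2 * A3 + 2 * A4 = 1"
    using sum unfolding \<alpha> by (simp add: add.assoc)
  show "rewritten_as \<epsilon> (original_system \<alpha>1 \<alpha>2 \<alpha>3 \<alpha>4 \<alpha>5) (transformed_system A0 A1 A2 A3 A4 \<epsilon>)"
    unfolding \<alpha> by (rule rewritten_as_transformed_system[OF \<open>\<epsilon> \<noteq> 0\<close> A])
  show "hamiltonian_system_on (- {0}) (transformed_hamiltonian A0 A1 A2 A3 A4 \<epsilon>)
      (transformed_system A0 A1 A2 A3 A4 \<epsilon>)"
    by (rule hamiltonian_transformed_system)
next
  fix T X Y Z W :: complex
  show "((\<lambda>\<epsilon>. transformed_system A0 A1 A2 A3 A4 \<epsilon> T (X, Y, Z, W)) \<longlongrightarrow>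
      B4_system A0 A1 A2 A3 T (X, Y, Z, W)) (at 0)"
    by (rule tendsto_transformed_system)
qed

end
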